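(* Let $G$ be a $2$-connected graph of order $n$ with minimum degree $\delta(G)$. If $$\delta(G) \geq 2n^{2/3}+ 6n^{1/3} + 2,$$ then $G$ contains a $2$-connected subgraph of order $\ell$ for every integer $\ell \in \{4,5,\dots,n\}$.
   Context: Graphs are finite, simple and undirected. The order of a graph is its number of vertices, and $\delta(G)$ denotes the minimum degree of $G$. A graph is $2$-connected if it has at least three vertices, is connected, and remains connected after the deletion of any single vertex. Subgraphs are not required to be induced. *)

theory Defs
  imports Complex_Main "Graph_Theory.Digraph_Component"
begin

text \<open>
  A finite simple undirected graph is a \<open>graph\<close>: a finite symmetric digraph without loops or
  parallel arcs. Every undirected edge is thus represented by two opposite arcs, and the degree of
  a vertex is its out-degree.
\<close>

lemma (in graph) out_degree_eq_card_neighbours: "out_degree G v = card {u. v \<rightarrow>\<^bsub>G\<^esub> u}"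
proof -
  have "bij_betw (head G) (out_arcs G v) {u. v \<rightarrow>\<^bsub>G\<^esub> u}"
    unfolding bij_betw_def
  proof
    show "inj_on (head G) (out_arcs G v)"
      by (rule inj_onI, rule no_multi_arcs) (auto simp: arc_to_ends_def)
    show "head G ` out_arcs G v = {u. v \<rightarrow>\<^bsub>G\<^esub> u}"
      by (auto simp: arcs_ends_conv)
  qed
  then show ?thesis
    unfolding out_degree_def by (rule bij_betw_same_card)
qed

definition min_degree :: "('a, 'b) pre_digraph \<Rightarrow> nat" where
  "min_degree G = Min (out_degree G ` verts G)"

text \<open>The name \<open>connected\<close> is qualified because it also denotes topological connectedness.\<close>

definition two_connected :: "('a, 'b) pre_digraph \<Rightarrow> bool" where
  "two_connected G \<longleftrightarrow>
     card (verts G) \<ge> 3 \<and>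
     Digraph_Component.connected G \<and>
     (\<forall>v \<in> verts G. Digraph_Component.connected (pre_digraph.del_vert G v))"

end

theory Submission
  imports Defs
begin

text \<open>
  Write \<open>\<delta>\<close> for the minimum degree, \<open>c\<close> for \<open>n powr (1/3)\<close>, and call a vertex set biconnected if it
  induces a \<open>2\<close>-connected subgraph.

  Counting paths of length two gives two vertices with at least \<open>\<delta> * (\<delta> - 1) / (n - 1)\<close>, so more
  than \<open>4 * c\<close>, common neighbours (\<open>many_common_nbrs\<close>). Together with any two or more of these common
  neighbours they span a \<open>2\<close>-connected graph, which settles all small orders
  (\<open>biconnected_common_nbrs\<close>).

  From then on, order \<open>k + 1\<close> is reached from a biconnected set \<open>X\<close> of order \<open>k\<close>
  (\<open>biconnected_extend\<close>). A vertex outside \<open>X\<close> with two neighbours in \<open>X\<close> can simply be added.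
  Suppose there is none. A shortest ear of \<open>X\<close> has few inner vertices, because neighbourhoods of
  inner vertices at distance at least three along the ear are disjoint outside \<open>X\<close>, and each of them has
  at least \<open>\<delta> - 1\<close> elements: this bounds the number \<open>t\<close> of inner vertices by \<open>3 / 2 * c\<close>
  (\<open>short_ear_exists\<close>). Adding the ear overshoots the order by \<open>t - 1\<close>, so \<open>t - 1\<close> vertices
  have to be deleted again, one at a time, without losing biconnectedness.

  That deletion is possible by a local form of a theorem of Kaugars, that a \<open>2\<close>-connected graph with
  minimum degree at least three has a vertex whose deletion leaves it \<open>2\<close>-connected. In the local
  form (\<open>removable_vertex\<close>) a set \<open>L\<close> of vertices may have arbitrary degree, provided that all other
  vertices have degree at least \<open>3 * card L + 3\<close>. Here \<open>L\<close> consists of the inner vertices of the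
  ear and of the vertices of \<open>X\<close> with many neighbours outside \<open>X\<close>. The latter are few, since every
  vertex outside \<open>X\<close> sends at most one edge into \<open>X\<close> (\<open>card_low_le\<close>). The rest of \<open>X\<close> loses
  only about half of its degree, while \<open>L\<close> has at most \<open>5 / 2 * c\<close> elements.
\<close>

section \<open>Connectedness of vertex sets\<close>

text \<open>
  Connectedness is expressed by edges leaving subsets rather than by paths: the separation arguments
  then become inclusions between sets. The empty set counts as linked.
\<close>

definition linked :: "('a \<Rightarrow> 'a \<Rightarrow> bool) \<Rightarrow> 'a set \<Rightarrow> bool" where
  "linked E X \<longleftrightarrow> (\<forall>P \<subseteq> X. P \<noteq> {} \<longrightarrow> P \<noteq> X \<longrightarrow> (\<exists>p \<in> P. \<exists>q \<in> X - P. E p q))"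

definition biconnected :: "('a \<Rightarrow> 'a \<Rightarrow> bool) \<Rightarrow> 'a set \<Rightarrow> bool" where
  "biconnected E X \<longleftrightarrow> finite X \<and> 3 \<le> card X \<and> linked E X \<and> (\<forall>v \<in> X. linked E (X - {v}))"

definition nbrs :: "('a \<Rightarrow> 'a \<Rightarrow> bool) \<Rightarrow> 'a set \<Rightarrow> 'a \<Rightarrow> 'a set" where
  "nbrs E X v = {u \<in> X. E v u}"

text \<open>
  \<open>A\<close> is a union of some, but not all, components of \<open>X - {x, y}\<close>. Cut vertices are the case
  \<open>x = y\<close>, which does not occur in biconnected sets.
\<close>

definition separates :: "('a \<Rightarrow> 'a \<Rightarrow> bool) \<Rightarrow> 'a set \<Rightarrow> 'a set \<Rightarrow> 'a \<Rightarrow> 'a \<Rightarrow> bool" where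
  "separates E X A x y \<longleftrightarrow> A \<subseteq> X \<and> A \<noteq> {} \<and> x \<in> X - A \<and> y \<in> X - A \<and> \<not> X \<subseteq> A \<union> {x, y} \<and>
     (\<forall>a \<in> A. nbrs E X a \<subseteq> A \<union> {x, y})"

text \<open>
  The list holds the inner vertices only, and its entries may repeat: a walk inside
  \<open>V - X\<close> is as good as a path until a shortest one is chosen.
\<close>

definition ear :: "('a \<Rightarrow> 'a \<Rightarrow> bool) \<Rightarrow> 'a set \<Rightarrow> 'a set \<Rightarrow> 'a list \<Rightarrow> bool" where
  "ear E V X p \<longleftrightarrow> p \<noteq> [] \<and> set p \<subseteq> V - X \<and> successively E p \<and>
     (\<exists>a \<in> X. \<exists>b \<in> X. a \<noteq> b \<and> E a (hd p) \<and> E (last p) b)"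

lemma exists_other:
  assumes "2 \<le> card S"
  shows "\<exists>b \<in> S. b \<noteq> a"
proof (rule ccontr)
  assume "\<not> ?thesis"
  then have "S \<subseteq> {a}" by blast
  then have "card S \<le> card {a}" by (intro card_mono) auto
  then show False using assms by simp
qed

lemma linkedD:
  assumes "linked E X" "P \<subseteq> X" "P \<noteq> {}" "P \<noteq> X"
  obtains p q where "p \<in> P" "q \<in> X - P" "E p q"
  using assms unfolding linked_def by blast

lemma linked_cong:
  assumes "\<And>x y. x \<in> X \<Longrightarrow> y \<in> X \<Longrightarrow> E x y \<longleftrightarrow> F x y"
  shows "linked E X \<longleftrightarrow> linked F X"
proof -
  have "linked F X" if "linked E X" "\<And>x y. x \<in> X \<Longrightarrow> y \<in> X \<Longrightarrow> E x y \<longleftrightarrow> F x y" for E F :: "'a \<Rightarrow> 'a \<Rightarrow> bool"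
    unfolding linked_def
  proof (intro allI impI)
    fix P assume P: "P \<subseteq> X" "P \<noteq> {}" "P \<noteq> X"
    then obtain p q where "p \<in> P" "q \<in> X - P" "E p q"
      by (rule linkedD[OF \<open>linked E X\<close>])
    then show "\<exists>p\<in>P. \<exists>q\<in>X - P. F p q"
      using that(2) P(1) by blast
  qed
  then show ?thesis
    using assms by metis
qed

lemma linked_insert:
  assumes sym: "symp E" and "linked E X" "a \<in> X" "E a v"
  shows "linked E (insert v X)"
  unfolding linked_def
proof (intro allI impI)
  fix P assume P: "P \<subseteq> insert v X" "P \<noteq> {}" "P \<noteq> insert v X"
  show "\<exists>p\<in>P. \<exists>q\<in>insert v X - P. E p q"
  proof (cases "P \<inter> X = {} \<or> X \<subseteq> P")
    case True
    then have "P = {v} \<and> v \<notin> X \<or> P = X \<and> v \<notin> X"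
      using P by blast
    then show ?thesis
      using assms(3,4) sympD[OF sym] by blast
  next
    case False
    then obtain p q where "p \<in> P \<inter> X" "q \<in> X - P \<inter> X" "E p q"
      using linkedD[OF assms(2), of "P \<inter> X"] by blast
    then show ?thesis by blast
  qed
qed

section \<open>Ears\<close>

lemma linked_Un_path:
  assumes sym: "symp E" and "linked E X" "a \<in> X" "successively E (a # p)"
  shows "linked E (X \<union> set p)"
  using assms(2-4)
proof (induction p arbitrary: a X)
  case Nil
  then show ?case by simp
next
  case (Cons v p)
  then have "linked E (insert v X)"
    using linked_insert[OF sym] by auto
  then show ?case
    using Cons.IH[of "insert v X" v] Cons.prems by simp
qed

lemma successively_rev_symp:
  assumes "symp E"
  shows "successively E (rev p) \<longleftrightarrow> successively E p"
proof -
  have "(\<lambda>x y. E y x) = E" using assms by (auto simp: symp_def fun_eq_iff)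
  then show ?thesis by (simp only: successively_rev)
qed

text \<open>
  After deletion of a vertex of \<open>X\<close>, one of the two ends of the ear is still attached to the rest of
  \<open>X\<close>, and the whole ear hangs on it. After deletion of a vertex of the ear, the two remaining pieces
  hang on \<open>X\<close> by one end each.
\<close>

lemma biconnected_Un_ear:
  assumes sym: "symp E" and X: "biconnected E X" and p: "ear E V X p" "distinct p"
  shows "biconnected E (X \<union> set p)"
proof -
  obtain a b where ab: "a \<in> X" "b \<in> X" "a \<noteq> b" "E a (hd p)" "E (last p) b" "p \<noteq> []"
    and succ: "successively E p" and disj: "set p \<inter> X = {}"
    using p unfolding ear_def by blast
  have fwd: "successively E (a # p)"
    using ab succ by (cases p) auto
  have "successively E (p @ [b])"
    using ab succ by (simp add: successively_append_iff)
  then have bwd: "successively E (b # rev p)"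
    using successively_rev_symp[OF sym, of "p @ [b]"] by simp
  have lX: "linked E X" and lXv: "\<And>v. v \<in> X \<Longrightarrow> linked E (X - {v})" and fin: "finite X" "3 \<le> card X"
    using X unfolding biconnected_def by auto
  have "linked E (X \<union> set p - {v})" if v: "v \<in> X \<union> set p" for v
  proof (cases "v \<in> X")
    case True
    have "linked E (X - {v} \<union> set p)"
    proof (cases "v = a")
      case True
      then have "linked E (X - {v} \<union> set (rev p))"
        using linked_Un_path[OF sym lXv _ bwd] ab True by blast
      then show ?thesis by simp
    next
      case False
      then show ?thesis
        using linked_Un_path[OF sym lXv _ fwd] ab True by blast
    qed
    moreover have "X - {v} \<union> set p = X \<union> set p - {v}"
      using disj True by blast
    ultimately show ?thesis by simp
  next
    case False
    then obtain p1 p2 where p12: "p = p1 @ v # p2"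
      using v split_list[of v p] by blast
    have s1: "successively E (a # p1)"
      using fwd p12 successively_append_iff[of E "a # p1" "v # p2"] by simp
    have s2: "successively E (b # rev p2)"
      using bwd p12 successively_append_iff[of E "b # rev p2" "v # rev p1"] by simp
    have "linked E (X \<union> set p1 \<union> set (rev p2))"
      using linked_Un_path[OF sym linked_Un_path[OF sym lX ab(1) s1] _ s2] ab(2) by blast
    moreover have "X \<union> set p1 \<union> set (rev p2) = X \<union> set p - {v}"
      using p(2) False unfolding p12 by auto
    ultimately show ?thesis by simp
  qed
  moreover have "linked E (X \<union> set p)"
    by (rule linked_Un_path[OF sym lX ab(1) fwd])
  moreover have "card X \<le> card (X \<union> set p)"
    by (rule card_mono) (use fin in auto)
  ultimately show ?thesis
    using fin unfolding biconnected_def by auto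
qed

lemma biconnected_insert:
  assumes sym: "symp E" and X: "biconnected E X" and v: "v \<notin> X" and two: "2 \<le> card (nbrs E X v)"
  shows "biconnected E (insert v X)"
proof -
  obtain a b where "a \<in> nbrs E X v" "b \<in> nbrs E X v" "a \<noteq> b"
    using exists_other[OF two] by metis
  then have "ear E (insert v X) X [v]"
    using v sympD[OF sym] unfolding ear_def nbrs_def by auto
  then show ?thesis
    using biconnected_Un_ear[OF sym X, of "insert v X" "[v]"] by simp
qed

text \<open>
  The form in which biconnectedness is used: a set whose only outside neighbour is \<open>x\<close> would be cut
  off by \<open>x\<close>.
\<close>

lemma biconnected_no_cut_vertex:
  assumes X: "biconnected E X" and "Z \<subseteq> X" "Z \<noteq> {}" "\<not> X \<subseteq> insert x Z" "x \<notin> Z"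
  shows "\<exists>z \<in> Z. \<not> nbrs E X z \<subseteq> insert x Z"
proof -
  have "linked E (X - {x})"
    using X unfolding biconnected_def by (cases "x \<in> X") auto
  then obtain p q where "p \<in> Z" "q \<in> X - {x} - Z" "E p q"
    by (rule linkedD[where P = Z]) (use assms in auto)
  then show ?thesis unfolding nbrs_def by blast
qed

text \<open>
  Start at a vertex outside \<open>X\<close> adjacent to some \<open>a \<in> X\<close> and walk within \<open>V - X\<close>. If no walk could
  come back to a vertex of \<open>X\<close> other than \<open>a\<close>, then \<open>a\<close> would be a cut vertex.
\<close>

lemma ear_exists:
  assumes V: "biconnected E V" and X: "X \<subseteq> V" "X \<noteq> V" "2 \<le> card X"
  shows "\<exists>p. ear E V X p"
proof (rule ccontr)
  assume no_ear: "\<nexists>p. ear E V X p"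
  have "X \<noteq> {}" using X(3) by auto
  moreover have "linked E V" using V unfolding biconnected_def by blast
  ultimately obtain a c0 where ac: "a \<in> X" "c0 \<in> V - X" "E a c0"
    using X(1,2) by (metis linkedD)
  define C where "C = {last p | p. p \<noteq> [] \<and> hd p = c0 \<and> set p \<subseteq> V - X \<and> successively E p}"
  have "c0 \<in> C"
    unfolding C_def using ac(2) by (intro CollectI exI[of _ "[c0]"]) auto
  have "C \<subseteq> V - X"
    unfolding C_def using last_in_set by fastforce
  obtain b where b: "b \<in> X" "b \<noteq> a"
    using exists_other[OF X(3)] by blast
  have "nbrs E V z \<subseteq> insert a C" if "z \<in> C" for z
  proof
    fix q assume q: "q \<in> nbrs E V z"
    obtain p where p: "p \<noteq> []" "hd p = c0" "set p \<subseteq> V - X" "successively E p" "z = last p"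
      using \<open>z \<in> C\<close> unfolding C_def by blast
    show "q \<in> insert a C"
    proof (cases "q \<in> X")
      case True
      have "q = a"
      proof (rule ccontr)
        assume "q \<noteq> a"
        then have "ear E V X p"
          unfolding ear_def using True p ac q
          by (intro conjI bexI[of _ a] bexI[of _ q]) (auto simp: nbrs_def)
        then show False using no_ear by blast
      qed
      then show ?thesis by simp
    next
      case False
      then have "last (p @ [q]) \<in> C"
        unfolding C_def using p q
        by (intro CollectI exI[of _ "p @ [q]"]) (auto simp: nbrs_def successively_append_iff)
      then show ?thesis by simp
    qed
  qed
  moreover have "\<exists>z \<in> C. \<not> nbrs E V z \<subseteq> insert a C"
  proof (rule biconnected_no_cut_vertex[OF V])
    have "b \<in> V - insert a C"
      using b X(1) \<open>C \<subseteq> V - X\<close> by blast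
    then show "\<not> V \<subseteq> insert a C" by blast
  qed (use \<open>C \<subseteq> V - X\<close> \<open>c0 \<in> C\<close> ac(1) in auto)
  ultimately show False by blast
qed

section \<open>Separating pairs and removable vertices\<close>

lemma not_biconnected_Diff_separates:
  assumes X: "biconnected E X" "4 \<le> card X" and u: "u \<in> X" "\<not> biconnected E (X - {u})"
  shows "\<exists>w P. w \<noteq> u \<and> separates E X P u w"
proof -
  have fin: "finite X" "linked E (X - {u})" "3 \<le> card (X - {u})"
    using X u unfolding biconnected_def by auto
  then obtain w where w: "w \<in> X - {u}" "\<not> linked E (X - {u} - {w})"
    using u unfolding biconnected_def by blast
  then obtain P where "P \<subseteq> X - {u} - {w}" "P \<noteq> {}" "P \<noteq> X - {u} - {w}"
    "\<forall>p \<in> P. \<forall>q \<in> X - {u} - {w} - P. \<not> E p q"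
    unfolding linked_def by blast
  then have "separates E X P u w"
    using w u unfolding separates_def nbrs_def by blast
  then show ?thesis using w by blast
qed

lemma separates_complement:
  assumes sym: "symp E" and "separates E X P x y"
  shows "separates E X (X - P - {x, y}) x y"
proof -
  have P: "P \<subseteq> X" "P \<noteq> {}" "x \<in> X - P" "y \<in> X - P" "\<not> X \<subseteq> P \<union> {x, y}"
    "\<And>a. a \<in> P \<Longrightarrow> nbrs E X a \<subseteq> P \<union> {x, y}"
    using assms(2) unfolding separates_def by auto
  have "b \<notin> P" if "a \<in> X - P - {x, y}" "b \<in> nbrs E X a" for a b
    using that P(6)[of b] sympD[OF sym, of a b] unfolding nbrs_def by blast
  then have "nbrs E X a \<subseteq> (X - P - {x, y}) \<union> {x, y}" if "a \<in> X - P - {x, y}" for a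
    using that unfolding nbrs_def by blast
  then show ?thesis
    using P(1-5) unfolding separates_def by blast
qed

text \<open>
  If the vertex \<open>u\<close> inside the separated set \<open>A\<close> cannot be deleted, it belongs to a second separating
  pair \<open>{u, w}\<close>, with sides \<open>P\<close> and \<open>Q\<close>. Let \<open>B\<close> be the side opposite to \<open>A\<close>. If \<open>w\<close> is not in \<open>B\<close>,
  the part of \<open>X\<close> outside \<open>A\<close> is not torn apart by \<open>{u, w}\<close>, so \<open>P\<close> or \<open>Q\<close> lies entirely within \<open>A\<close>.
  If \<open>w\<close> is in \<open>B\<close>, the pairs cross: \<open>x\<close> and \<open>y\<close> lie on different sides, and each of
  the quarters \<open>A \<inter> P\<close> and \<open>A \<inter> Q\<close>, unless empty, is separated by \<open>u\<close> together with \<open>x\<close> or \<open>y\<close>.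
  As \<open>A\<close> has a vertex besides \<open>u\<close>, they are not both empty. Either way a
  smaller separated set with \<open>u\<close> on its boundary appears inside \<open>A\<close>.
\<close>

lemma separates_shrink:
  assumes sym: "symp E" and X: "biconnected E X" "4 \<le> card X"
    and A: "separates E X A x y" and u: "u \<in> A" "A \<noteq> {u}" "\<not> biconnected E (X - {u})"
  shows "\<exists>A' w. A' \<subset> A \<and> separates E X A' u w"
proof -
  have AX: "A \<subseteq> X" "x \<in> X - A" "y \<in> X - A" and nA: "\<And>a. a \<in> A \<Longrightarrow> nbrs E X a \<subseteq> A \<union> {x, y}"
    using A unfolding separates_def by auto
  define B where "B = X - A - {x, y}"
  have B: "B \<noteq> {}" "B \<subseteq> X" "B \<inter> A = {}" "x \<notin> B" "y \<notin> B" "u \<notin> B"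
    using A u unfolding separates_def B_def by auto
  have nB: "\<And>b. b \<in> B \<Longrightarrow> nbrs E X b \<subseteq> B \<union> {x, y}"
    using separates_complement[OF sym A] unfolding separates_def B_def by auto
  obtain w P where w: "w \<noteq> u" and P: "separates E X P u w"
    using not_biconnected_Diff_separates[OF X _ u(3)] u(1) AX(1) by blast
  define Q where "Q = X - P - {u, w}"
  have Q: "separates E X Q u w"
    using separates_complement[OF sym P] unfolding Q_def .
  have sepD: "R \<subseteq> X" "R \<noteq> {}" "u \<in> X - R" "w \<in> X - R" "\<And>a. a \<in> R \<Longrightarrow> nbrs E X a \<subseteq> R \<union> {u, w}"
    if "separates E X R u w" for R
    using that unfolding separates_def by auto
  have cover: "X = P \<union> Q \<union> {u, w}" "P \<inter> Q = {}"
    using sepD[OF P] sepD[OF Q] unfolding Q_def by blast+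
  have no_cut: "Z = {}" if "Z \<subseteq> X" "\<And>z. z \<in> Z \<Longrightarrow> nbrs E X z \<subseteq> insert c Z" "c \<notin> Z" "\<not> X \<subseteq> insert c Z" for Z c
    using biconnected_no_cut_vertex[OF X(1) that(1) _ that(4,3)] that(2) by blast
  show ?thesis
  proof (cases "w \<in> B")
    case False
    (* A side avoiding x and y meets B in a set whose only possible outside neighbour is w. *)
    have one_sided: ?thesis if R: "separates E X R u w" and "x \<notin> R" "y \<notin> R" for R
    proof -
      note R' = sepD[OF R]
      have "B \<inter> R = {}"
      proof (rule no_cut[where c = w])
        fix z assume z: "z \<in> B \<inter> R"
        then have "nbrs E X z \<subseteq> (B \<union> {x, y}) \<inter> (R \<union> {u, w})"
          using nB R'(5) by blast
        then show "nbrs E X z \<subseteq> insert w (B \<inter> R)"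
          using that B(6) False AX u(1) by blast
      qed (use B R' w False in blast)+
      then have "R \<subseteq> A"
        using R' that unfolding B_def by blast
      then show ?thesis
        using R R' u(1) by blast
    qed
    (* If x and y lie on different sides, then B has on each side at most one outside neighbour. *)
    have cross: "B \<inter> R = {}" if R: "separates E X R u w" and c: "R \<inter> {x, y} \<subseteq> {c}" "w \<notin> {x, y}" "c \<notin> B" "c \<noteq> u" for R c
    proof (rule no_cut[where c = c])
      note R' = sepD[OF R]
      fix z assume z: "z \<in> B \<inter> R"
      then have "nbrs E X z \<subseteq> (B \<union> {x, y}) \<inter> (R \<union> {u, w})"
        using nB R'(5) by blast
      then show "nbrs E X z \<subseteq> insert c (B \<inter> R)"
        using c False B(6) AX u(1) by blast
    next
      have "u \<in> X - insert c (B \<inter> R)"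
        using B(6) c(4) AX(1) u(1) by blast
      then show "\<not> X \<subseteq> insert c (B \<inter> R)" by blast
    qed (use B(2) c(3) in auto)
    show ?thesis
    proof (rule ccontr)
      assume contr: "\<not> ?thesis"
      then have "x \<in> P \<or> y \<in> P" "x \<in> Q \<or> y \<in> Q"
        using one_sided[OF P] one_sided[OF Q] by blast+
      then have xy: "x \<in> P \<and> y \<in> Q \<or> y \<in> P \<and> x \<in> Q"
        using cover(2) by blast
      then have wxy: "w \<notin> {x, y}"
        using sepD(4)[OF P] sepD(4)[OF Q] by blast
      have "B \<inter> P = {}" "B \<inter> Q = {}"
        using cross[OF P _ wxy, of x] cross[OF P _ wxy, of y] cross[OF Q _ wxy, of x] cross[OF Q _ wxy, of y]
          xy cover(2) B AX u(1) by blast+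
      then show False
        using B cover(1) False by blast
    qed
  next
    case True
    (* A side avoiding x and y would split into a part of A attached only to u and a part of B
       attached only to w. *)
    have meets: "x \<in> R \<or> y \<in> R" if R: "separates E X R u w" for R
    proof (rule ccontr)
      assume "\<not> (x \<in> R \<or> y \<in> R)"
      then have xy: "x \<notin> R" "y \<notin> R" by auto
      note R' = sepD[OF R]
      have "A \<inter> R = {}"
      proof (rule no_cut[where c = u])
        fix z assume z: "z \<in> A \<inter> R"
        then have "nbrs E X z \<subseteq> (A \<union> {x, y}) \<inter> (R \<union> {u, w})"
          using nA R'(5) by blast
        then show "nbrs E X z \<subseteq> insert u (A \<inter> R)"
          using xy True B by blast
      qed (use R' w in blast)+
      moreover have "B \<inter> R = {}"
      proof (rule no_cut[where c = w])
        fix z assume z: "z \<in> B \<inter> R"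
        then have "nbrs E X z \<subseteq> (B \<union> {x, y}) \<inter> (R \<union> {u, w})"
          using nB R'(5) by blast
        then show "nbrs E X z \<subseteq> insert w (B \<inter> R)"
          using xy B AX u(1) by blast
      qed (use R' w in blast)+
      ultimately show False
        using R'(1,2) xy unfolding B_def by blast
    qed
    have quarter: ?thesis if R: "separates E X R u w" and c: "R \<inter> {x, y} \<subseteq> {c}" "c \<in> {x, y}" and ne: "A \<inter> R \<noteq> {}" for R c
    proof -
      note R' = sepD[OF R]
      have "nbrs E X z \<subseteq> A \<inter> R \<union> {u, c}" if "z \<in> A \<inter> R" for z
      proof -
        have "nbrs E X z \<subseteq> (A \<union> {x, y}) \<inter> (R \<union> {u, w})"
          using that nA R'(5) by blast
        then show ?thesis
          using c True B by blast
      qed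
      moreover have "w \<in> X - (A \<inter> R \<union> {u, c})"
        using True B w c by blast
      ultimately have "separates E X (A \<inter> R) u c"
        unfolding separates_def using ne AX R' c by blast
      then show ?thesis
        using R'(3) u(1) by blast
    qed
    have "x \<in> P \<and> y \<in> Q \<or> y \<in> P \<and> x \<in> Q"
      using meets[OF P] meets[OF Q] cover(2) by blast
    moreover have "A \<inter> P \<noteq> {} \<or> A \<inter> Q \<noteq> {}"
      using u cover(1) AX(1) True B(3) by blast
    ultimately show ?thesis
      using quarter[OF P, of x] quarter[OF P, of y] quarter[OF Q, of x] quarter[OF Q, of y] cover(2)
      by blast
  qed
qed

text \<open>
  Suppose that no vertex outside \<open>L\<close> can be deleted, and take a smallest separated set \<open>A\<close> not
  contained in \<open>L\<close>. It contains a vertex outside \<open>L\<close> together with almost all neighbours of this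
  vertex, so \<open>A\<close> has more than \<open>3 * card L\<close> elements. Each \<open>u \<in> A - L\<close> is on the boundary of a smaller
  separated set \<open>A'\<close> by \<open>separates_shrink\<close>, and \<open>A' \<subseteq> L\<close> by minimality. So \<open>u\<close> has a neighbour
  \<open>z \<in> A'\<close>, and all neighbours of \<open>z\<close> outside \<open>L\<close> belong to the two-element boundary of \<open>A'\<close>. As at
  most two vertices \<open>u\<close> share the same \<open>z\<close>, the set \<open>A - L\<close> has at most \<open>2 * card L\<close> elements,
  and \<open>A\<close> at most \<open>3 * card L\<close>: a contradiction.

  For \<open>L = {}\<close> this is Kaugars' theorem.
\<close>

lemma removable_vertex:
  assumes sym: "symp E" and irr: "irreflp E" and bX: "biconnected E X"
    and L: "finite L" "\<not> X \<subseteq> L"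
    and deg: "\<And>v. v \<in> X - L \<Longrightarrow> 3 * card L + 3 \<le> card (nbrs E X v)"
  shows "\<exists>u \<in> X - L. biconnected E (X - {u})"
proof (rule ccontr)
  assume "\<not> ?thesis"
  then have crit: "\<And>u. u \<in> X - L \<Longrightarrow> \<not> biconnected E (X - {u})" by blast
  have fin: "finite X" using bX unfolding biconnected_def by blast
  have big: "3 * card L + 2 \<le> card A"
    if "u \<in> X - L" "u \<in> A" "nbrs E X u \<subseteq> A \<union> {x, y}" "finite A" for A u x y
  proof -
    have sub: "nbrs E X u \<subseteq> (A - {u}) \<union> {x, y}"
      using that(3) irr unfolding nbrs_def irreflp_def by auto
    have "3 * card L + 3 \<le> card (nbrs E X u)"
      by (rule deg[OF that(1)])
    also have "\<dots> \<le> card ((A - {u}) \<union> {x, y})"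
      by (rule card_mono[OF _ sub]) (use that(4) in simp)
    also have "\<dots> \<le> card (A - {u}) + card {x, y}"
      by (rule card_Un_le)
    also have "card {x, y} \<le> 2"
      by (simp add: card_insert_if)
    finally have "3 * card L + 3 \<le> (card A - 1) + 2"
      using that by simp
    moreover have "0 < card A"
      using that by (auto simp: card_gt_0_iff)
    ultimately show ?thesis by linarith
  qed
  obtain v where v: "v \<in> X - L" using L(2) by blast
  have "nbrs E X v \<subseteq> X - {v}"
    using irr unfolding nbrs_def irreflp_def by auto
  then have "3 \<le> card (X - {v})"
    using deg[OF v] card_mono[of "X - {v}" "nbrs E X v"] fin by simp
  then have "4 \<le> card X"
    using v fin by simp
  with bX have X: "biconnected E X" "4 \<le> card X" by auto
  obtain w P where P: "separates E X P v w"
    using not_biconnected_Diff_separates[OF X _ crit[OF v]] v by blast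
  have Q: "separates E X (X - P - {v, w}) v w"
    using separates_complement[OF sym P] .
  have "\<not> P \<subseteq> L \<or> \<not> X - P - {v, w} \<subseteq> L"
  proof (rule ccontr)
    assume "\<not> ?thesis"
    then have "nbrs E X v \<subseteq> insert v L \<union> {w, w}" unfolding nbrs_def by blast
    from big[OF v _ this] show False using L(1) by (simp add: card_insert_if split: if_splits)
  qed
  then have "\<exists>A. \<not> A \<subseteq> L \<and> (\<exists>x y. separates E X A x y)"
    using P Q by metis
  then obtain A where A: "\<not> A \<subseteq> L \<and> (\<exists>x y. separates E X A x y)"
    and min: "\<And>A'. \<not> A' \<subseteq> L \<and> (\<exists>x y. separates E X A' x y) \<Longrightarrow> card A \<le> card A'"
    using ex_has_least_nat[of "\<lambda>A. \<not> A \<subseteq> L \<and> (\<exists>x y. separates E X A x y)" _ card] by metis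
  obtain x y where sA: "separates E X A x y" using A by blast
  have AX: "A \<subseteq> X" "finite A"
    using sA fin unfolding separates_def by (auto dest: finite_subset)
  obtain v' where v': "v' \<in> A - L" using A by blast
  have "nbrs E X v' \<subseteq> A \<union> {x, y}"
    using sA v' unfolding separates_def by blast
  from big[OF _ _ this AX(2)] have cardA: "3 * card L + 2 \<le> card A"
    using v' AX(1) by blast
  (* The vertices u for which z can serve as the neighbour inside a small separated set. *)
  define attach where
    "attach z = {u \<in> A - L. \<exists>A' w. A' \<subseteq> L \<and> z \<in> A' \<and> u \<in> nbrs E X z \<and> separates E X A' u w}" for z
  have attach_le: "card (attach z) \<le> 2" for z
  proof (cases "attach z = {}")
    case False
    then obtain u A' w where "A' \<subseteq> L" "z \<in> A'" "separates E X A' u w"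
      unfolding attach_def by blast
    then have "attach z \<subseteq> {u, w}"
      unfolding attach_def separates_def by blast
    then have "card (attach z) \<le> card {u, w}"
      by (intro card_mono) auto
    also have "\<dots> \<le> 2" by (simp add: card_insert_if)
    finally show ?thesis .
  qed simp
  have "A - L \<subseteq> (\<Union>z \<in> L. attach z)"
  proof
    fix u assume u: "u \<in> A - L"
    have "A \<noteq> {u}"
      using cardA by auto
    then obtain A' w' where A': "A' \<subset> A" "separates E X A' u w'"
      using separates_shrink[OF sym X sA, of u] crit[of u] u AX by blast
    have "A' \<subseteq> L"
      using min[of A'] A' psubset_card_mono[OF AX(2) A'(1)] by force
    obtain z where z: "z \<in> A'" "u \<in> nbrs E X z"
    proof -
      have "\<exists>z\<in>A'. \<not> nbrs E X z \<subseteq> insert w' A'"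
        by (rule biconnected_no_cut_vertex[OF bX]) (use A'(2) in \<open>auto simp: separates_def\<close>)
      then show ?thesis
        using that A'(2) unfolding separates_def by blast
    qed
    then show "u \<in> (\<Union>z \<in> L. attach z)"
      unfolding attach_def using u A' \<open>A' \<subseteq> L\<close> by blast
  qed
  then have "card (A - L) \<le> card (\<Union>z \<in> L. attach z)"
    by (intro card_mono) (use L AX in \<open>auto simp: attach_def\<close>)
  also have "\<dots> \<le> (\<Sum>z \<in> L. card (attach z))"
    by (rule card_UN_le[OF L(1)])
  also have "\<dots> \<le> 2 * card L"
    using sum_bounded_above[of L "\<lambda>z. card (attach z)" 2] attach_le by simp
  finally have "card (A - L) \<le> 2 * card L" .
  moreover have "card A \<le> card (A - L) + card L"
    using card_mono[of "(A - L) \<union> L" A] card_Un_le[of "A - L" L] AX L by simp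
  ultimately show False using cardA by simp
qed

section \<open>Short ears\<close>

text \<open>
  In an ear with the fewest inner vertices, a repeated vertex or a common neighbour \<open>u\<close> of two inner
  vertices at distance more than two would give a shortcut. The second neighbourhood is written as
  \<open>{u. E u (p ! j)}\<close>, with the edge in the direction in which the shortcut runs through it.
\<close>

lemma shortest_ear:
  assumes "ear E V X p0"
  shows "\<exists>p. ear E V X p \<and> distinct p \<and>
    (\<forall>i j. i + 2 < j \<longrightarrow> j < length p \<longrightarrow> nbrs E (V - X) (p ! i) \<inter> {u. E u (p ! j)} = {})"
proof -
  obtain p where p: "ear E V X p" and min: "\<And>p'. ear E V X p' \<Longrightarrow> length p \<le> length p'"
    using ex_has_least_nat[of "ear E V X" p0 length] assms by blast
  have succ: "successively E p" and ne: "p \<noteq> []" and inV: "set p \<subseteq> V - X"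
    using p unfolding ear_def by auto
  have succ_take: "successively E (take k p)" and succ_drop: "successively E (drop k p)" for k
    using succ successively_append_iff[of E "take k p" "drop k p"] by simp_all
  have ends: "hd (take (Suc i) p) = hd p" "last (drop j p) = last p" "last (take (Suc i) p) = p ! i"
    "hd (drop j p) = p ! j"
    if "i < j" "j < length p" for i j
  proof -
    show "hd (take (Suc i) p) = hd p" by (cases p) (use ne in auto)
  qed (use that in \<open>auto simp: last_drop hd_drop_conv_nth take_Suc_conv_app_nth\<close>)
  have ear_of: "ear E V X p'" if "p' \<noteq> []" "set p' \<subseteq> V - X" "successively E p'" "hd p' = hd p" "last p' = last p" for p'
    using p that unfolding ear_def by simp
  have "p ! i \<noteq> p ! j" if ij: "i < j" "j < length p" for i j
  proof
    assume eq: "p ! i = p ! j"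
    have "ear E V X (take i p @ drop j p)"
    proof (rule ear_of)
      show "set (take i p @ drop j p) \<subseteq> V - X"
        using inV set_take_subset[of i p] set_drop_subset[of j p] by auto
      have "E (last (take i p)) (p ! i)" if "i \<noteq> 0"
      proof -
        have "successively E (take i p @ [p ! i])"
          using succ_take[of "Suc i"] ij by (simp add: take_Suc_conv_app_nth)
        then show ?thesis
          using that ne by (simp add: successively_append_iff)
      qed
      then show "successively E (take i p @ drop j p)"
        using succ_take succ_drop ends(4)[OF ij] eq by (auto simp: successively_append_iff)
      show "hd (take i p @ drop j p) = hd p"
        using ij ends(4)[OF ij] eq ne by (cases "i = 0") (auto simp: hd_append hd_conv_nth)
      show "last (take i p @ drop j p) = last p"
        using ij by (simp add: last_append last_drop)
    qed (use ij in simp)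
    from min[OF this] show False using ij by simp
  qed
  then have "distinct p"
    unfolding distinct_conv_nth by (metis linorder_neqE_nat)
  moreover have "nbrs E (V - X) (p ! i) \<inter> {u. E u (p ! j)} = {}" if ij: "i + 2 < j" "j < length p" for i j
  proof (rule ccontr)
    assume "\<not> ?thesis"
    then obtain u where u: "u \<in> V - X" "E (p ! i) u" "E u (p ! j)"
      unfolding nbrs_def by blast
    have "i < j" using ij by simp
    note e = ends[OF this ij(2)]
    have "ear E V X (take (Suc i) p @ u # drop j p)"
    proof (rule ear_of)
      show "set (take (Suc i) p @ u # drop j p) \<subseteq> V - X"
        using inV u(1) set_take_subset[of "Suc i" p] set_drop_subset[of j p] by auto
      show "successively E (take (Suc i) p @ u # drop j p)"
        using succ_take succ_drop e u by (auto simp: successively_append_iff successively_Cons)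
      show "hd (take (Suc i) p @ u # drop j p) = hd p"
        using e ne by simp
      show "last (take (Suc i) p @ u # drop j p) = last p"
        using ij by (simp add: last_append last_drop)
    qed simp
    from min[OF this] show False using ij by simp
  qed
  ultimately show ?thesis using p by blast
qed

lemma card_nbrs_split:
  assumes "finite V" "X \<subseteq> V"
  shows "card (nbrs E V v) = card (nbrs E X v) + card (nbrs E (V - X) v)"
proof -
  have "nbrs E V v = nbrs E X v \<union> nbrs E (V - X) v" "nbrs E X v \<inter> nbrs E (V - X) v = {}"
    using assms(2) unfolding nbrs_def by auto
  moreover have "finite (nbrs E X v)" "finite (nbrs E (V - X) v)"
    using finite_subset[OF assms(2,1)] assms(1) unfolding nbrs_def by auto
  ultimately show ?thesis by (simp add: card_Un_disjoint)
qed

lemma sum_card_nbrs_swap: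
  assumes "symp E" "finite A" "finite B"
  shows "(\<Sum>v\<in>A. card (nbrs E B v)) = (\<Sum>w\<in>B. card (nbrs E A w))"
proof -
  have card_eq: "card (nbrs E B v) = (\<Sum>w\<in>B. if E v w then 1 else 0)" if "finite B" for B v
    using that unfolding nbrs_def by (simp add: sum.If_cases Int_def)
  have "(\<Sum>v\<in>A. card (nbrs E B v)) = (\<Sum>w\<in>B. \<Sum>v\<in>A. if E v w then 1 else 0)"
    unfolding card_eq[OF assms(3)] by (rule sum.swap)
  also have "\<dots> = (\<Sum>w\<in>B. card (nbrs E A w))"
    unfolding card_eq[OF assms(2)] using sympD[OF assms(1)] by (intro sum.cong) (auto intro!: sum.cong)
  finally show ?thesis .
qed

text \<open>
  Every third inner vertex of a shortest ear is selected. Their neighbourhoods in \<open>V - X\<close> are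
  pairwise disjoint and have at least \<open>d - 1\<close> elements each.
\<close>

lemma short_ear_exists:
  assumes sym: "symp E" and V: "biconnected E V"
    and deg: "\<And>v. v \<in> V \<Longrightarrow> d \<le> card (nbrs E V v)" and d: "2 \<le> d"
    and X: "X \<subseteq> V" "X \<noteq> V" "2 \<le> card X"
    and closed: "\<And>v. v \<in> V - X \<Longrightarrow> card (nbrs E X v) \<le> 1"
  shows "\<exists>p. ear E V X p \<and> distinct p \<and> length p \<le> 3 * (card V div (d - 1))"
proof -
  have fin: "finite V" using V unfolding biconnected_def by blast
  obtain p where p: "ear E V X p" "distinct p"
    and far: "\<And>i j. i + 2 < j \<Longrightarrow> j < length p \<Longrightarrow> nbrs E (V - X) (p ! i) \<inter> {u. E u (p ! j)} = {}"
    using ear_exists[OF V X] shortest_ear by metis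
  define R where "R = (length p + 2) div 3"
  define N where "N r = nbrs E (V - X) (p ! (3 * r))" for r
  have idx: "3 * r < length p" if "r < R" for r
    using that unfolding R_def by presburger
  have "d - 1 \<le> card (N r)" if "r < R" for r
  proof -
    have "p ! (3 * r) \<in> V - X"
      using p(1) idx[OF that] nth_mem unfolding ear_def by blast
    then show ?thesis
      using deg[of "p ! (3 * r)"] closed[of "p ! (3 * r)"] card_nbrs_split[OF fin X(1), of E "p ! (3 * r)"]
      unfolding N_def by simp
  qed
  moreover have "N r \<inter> N s = {}" if "r < s" "s < R" for r s
  proof -
    have "nbrs E (V - X) (p ! (3 * r)) \<inter> {u. E u (p ! (3 * s))} = {}"
      by (rule far) (use that idx in auto)
    then show ?thesis
      using sympD[OF sym] unfolding N_def nbrs_def by blast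
  qed
  then have "\<forall>r\<in>{..<R}. \<forall>s\<in>{..<R}. r \<noteq> s \<longrightarrow> N r \<inter> N s = {}"
    by (metis inf_commute lessThan_iff linorder_neqE_nat)
  moreover have finN: "\<And>r. finite (N r)"
    using fin unfolding N_def nbrs_def by simp
  ultimately have "R * (d - 1) \<le> card (\<Union>r<R. N r)"
    using sum_bounded_below[of "{..<R}" "d - 1" "\<lambda>r. card (N r)"]
    by (simp add: card_UN_disjoint)
  also have "\<dots> \<le> card V"
    by (rule card_mono[OF fin]) (auto simp: N_def nbrs_def)
  finally have "R \<le> card V div (d - 1)"
    using d by (simp add: less_eq_div_iff_mult_less_eq)
  moreover have "length p \<le> 3 * R"
    unfolding R_def by presburger
  ultimately have "length p \<le> 3 * (card V div (d - 1))"
    by linarith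
  then show ?thesis using p by blast
qed

text \<open>
  Double counting of the edges between \<open>X\<close> and \<open>V - X\<close>: there are at most \<open>card (V - X)\<close> of them, and
  each of the vertices in question absorbs at least \<open>a + 1\<close>.
\<close>

lemma card_low_le:
  assumes "symp E" "finite V" "X \<subseteq> V"
    and closed: "\<And>v. v \<in> V - X \<Longrightarrow> card (nbrs E X v) \<le> 1"
  shows "card {v \<in> X. a < card (nbrs E (V - X) v)} \<le> card V div (a + 1)"
proof -
  define L where "L = {v \<in> X. a < card (nbrs E (V - X) v)}"
  have finX: "finite X" using assms finite_subset by blast
  have "card L * (a + 1) \<le> (\<Sum>v\<in>L. card (nbrs E (V - X) v))"
    using sum_bounded_below[of L "a + 1" "\<lambda>v. card (nbrs E (V - X) v)"] unfolding L_def by simp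
  also have "\<dots> \<le> (\<Sum>v\<in>X. card (nbrs E (V - X) v))"
    by (rule sum_mono2) (use finX in \<open>auto simp: L_def\<close>)
  also have "\<dots> = (\<Sum>w\<in>V - X. card (nbrs E X w))"
    by (rule sum_card_nbrs_swap) (use assms finX in auto)
  also have "\<dots> \<le> card (V - X)"
    using sum_bounded_above[of "V - X" "\<lambda>w. card (nbrs E X w)" 1] closed by simp
  also have "\<dots> \<le> card V"
    by (rule card_mono) (use assms in auto)
  finally show ?thesis
    unfolding L_def by (simp add: less_eq_div_iff_mult_less_eq)
qed

section \<open>From one order to the next\<close>

text \<open>
  With \<open>m = card V div (d - 1)\<close> and \<open>q = card V div (a + 1)\<close>, an ear with \<open>t \<le> 3 * m\<close> inner vertices
  is added and \<open>t - 1\<close> vertices are deleted by means of \<open>removable_vertex\<close>, where \<open>L\<close> has at most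
  \<open>q + t\<close> elements. A vertex outside \<open>L\<close> has lost at most \<open>a\<close> neighbours to \<open>V - X\<close> and at most
  \<open>t - 2\<close> to earlier deletions, so \<open>d \<ge> a + (t - 2) + 3 * (q + t) + 3\<close> suffices for the degrees. The
  second numerical hypothesis guarantees that vertices outside \<open>L\<close> are left over.
\<close>

lemma biconnected_extend:
  assumes sym: "symp E" and irr: "irreflp E" and V: "biconnected E V"
    and deg: "\<And>v. v \<in> V \<Longrightarrow> d \<le> card (nbrs E V v)" and d: "2 \<le> d"
    and X: "X \<subseteq> V" "X \<noteq> V" "biconnected E X"
    and num: "12 * (card V div (d - 1)) + 3 * (card V div (a + 1)) + a + 1 \<le> d"
      "3 * (card V div (d - 1)) + card V div (a + 1) \<le> card X"
  shows "\<exists>Y \<subseteq> V. biconnected E Y \<and> card Y = card X + 1"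
proof (cases "\<exists>v \<in> V - X. 2 \<le> card (nbrs E X v)")
  case True
  then obtain v where v: "v \<in> V - X" "2 \<le> card (nbrs E X v)" by blast
  have "biconnected E (insert v X)"
    using biconnected_insert[OF sym X(3)] v by blast
  moreover have "card (insert v X) = card X + 1"
    using v X(3) unfolding biconnected_def by simp
  ultimately show ?thesis using v X(1) by blast
next
  case False
  then have closed: "\<And>v. v \<in> V - X \<Longrightarrow> card (nbrs E X v) \<le> 1" by force
  have fin: "finite V" "finite X" and cardX: "2 \<le> card X"
    using V X(3) unfolding biconnected_def by auto
  obtain p where p: "ear E V X p" "distinct p" and len: "length p \<le> 3 * (card V div (d - 1))"
    using short_ear_exists[OF sym V deg d X(1,2) cardX closed] by blast
  define t where "t = length p"
  define low where "low = {v \<in> X. a < card (nbrs E (V - X) v)}"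
  have low: "card low \<le> card V div (a + 1)"
    unfolding low_def using card_low_le[OF sym fin(1) X(1) closed] .
  define L where "L = low \<union> set p"
  have finL: "finite L" unfolding L_def low_def using fin by simp
  have cardL: "card L \<le> card V div (a + 1) + t"
    unfolding L_def using card_Un_le[of low "set p"] low distinct_card[OF p(2)] unfolding t_def by simp
  define Z where "Z = X \<union> set p"
  have ZV: "Z \<subseteq> V" and t0: "0 < t" and disj: "X \<inter> set p = {}"
    using p(1) X(1) unfolding ear_def Z_def t_def by auto
  have cardZ: "card Z = card X + t" and finZ: "finite Z"
    unfolding Z_def t_def using card_Un_disjoint[OF fin(2) _ disj] distinct_card[OF p(2)] fin by auto
  have "\<exists>Y \<subseteq> Z. biconnected E Y \<and> card Y = card X + t - s" if "s < t" for s
    using that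
  proof (induction s)
    case 0
    then show ?case
      using biconnected_Un_ear[OF sym X(3) p] cardZ unfolding Z_def by (intro exI[of _ "X \<union> set p"]) simp
  next
    case (Suc s)
    then obtain Y where Y: "Y \<subseteq> Z" "biconnected E Y" "card Y = card X + t - s" by auto
    have finY: "finite Y" using Y(1) finZ finite_subset by blast
    have "\<not> Y \<subseteq> L"
    proof
      assume "Y \<subseteq> L"
      then have "card Y \<le> card L" using finL by (rule card_mono[rotated])
      then show False
        using Y(3) cardL num(2) len Suc.prems unfolding t_def by linarith
    qed
    moreover have "3 * card L + 3 \<le> card (nbrs E Y v)" if v: "v \<in> Y - L" for v
    proof -
      have "v \<in> X" "card (nbrs E (V - X) v) \<le> a"
        using v Y(1) unfolding L_def low_def Z_def by auto
      then have "d \<le> card (nbrs E X v) + a"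
        using deg[of v] card_nbrs_split[OF fin(1) X(1), of E v] X(1) by auto
      moreover have "card (nbrs E X v) \<le> card (nbrs E Y v \<union> (Z - Y))"
        using finY finZ by (intro card_mono) (auto simp: nbrs_def Z_def)
      then have "card (nbrs E X v) \<le> card (nbrs E Y v) + card (Z - Y)"
        using card_Un_le[of "nbrs E Y v" "Z - Y"] by linarith
      moreover have "card (Z - Y) = s"
        using card_Diff_subset[OF finY Y(1)] Y(3) cardZ Suc.prems by simp
      ultimately show ?thesis
        using num(1) cardL len Suc.prems unfolding t_def by linarith
    qed
    ultimately obtain u where u: "u \<in> Y - L" "biconnected E (Y - {u})"
      using removable_vertex[OF sym irr Y(2) finL] by blast
    moreover have "card (Y - {u}) = card X + t - Suc s"
      using u(1) Y(3) by simp
    ultimately show ?case using Y(1) by blast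
  qed
  from this[of "t - 1"] obtain Y where "Y \<subseteq> Z" "biconnected E Y" "card Y = card X + 1"
    using t0 by auto
  then show ?thesis using ZV by blast
qed

section \<open>Small orders\<close>

lemma biconnected_common_nbrs:
  assumes sym: "symp E" and uv: "u \<noteq> v" "u \<notin> C" "v \<notin> C"
    and C: "2 \<le> card C" "\<And>c. c \<in> C \<Longrightarrow> E u c \<and> E v c"
  shows "biconnected E ({u, v} \<union> C)"
proof -
  have star: "linked E (insert x D)" if "D \<subseteq> C" "x = u \<or> x = v" for x D
    unfolding linked_def
  proof (intro allI impI)
    fix P assume P: "P \<subseteq> insert x D" "P \<noteq> {}" "P \<noteq> insert x D"
    have "E x c \<and> E c x" if "c \<in> D" for c
      using that \<open>D \<subseteq> C\<close> \<open>x = u \<or> x = v\<close> C(2) sympD[OF sym] by blast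
    then show "\<exists>p\<in>P. \<exists>q\<in>insert x D - P. E p q"
      using P by (cases "x \<in> P") blast+
  qed
  have both: "linked E ({u, v} \<union> D)" if "D \<subseteq> C" "D \<noteq> {}" for D
  proof -
    obtain c where c: "c \<in> D" using \<open>D \<noteq> {}\<close> by blast
    then have "linked E (insert v (insert u D))"
      using linked_insert[OF sym star, of D u c v] c that(1) C(2) sympD[OF sym] by blast
    then show ?thesis by (simp add: insert_commute)
  qed
  have finC: "finite C" using C(1) card.infinite by fastforce
  have "linked E ({u, v} \<union> C - {x})" if x: "x \<in> {u, v} \<union> C" for x
  proof -
    consider "x = u" | "x = v" | "x \<in> C" "x \<noteq> u" "x \<noteq> v" using x uv by blast
    then show ?thesis
    proof cases
      case 1
      then have "{u, v} \<union> C - {x} = insert v C" using uv by blast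
      then show ?thesis using star[of C v] by simp
    next
      case 2
      then have "{u, v} \<union> C - {x} = insert u C" using uv by blast
      then show ?thesis using star[of C u] by simp
    next
      case 3
      then have "{u, v} \<union> C - {x} = {u, v} \<union> (C - {x})" by blast
      moreover have "C - {x} \<noteq> {}" using exists_other[OF C(1), of x] by blast
      ultimately show ?thesis using both[of "C - {x}"] by simp
    qed
  qed
  moreover have "linked E ({u, v} \<union> C)"
    by (rule both) (use C(1) in auto)
  moreover have "card ({u, v} \<union> C) = card C + 2"
    using finC uv by simp
  ultimately show ?thesis
    unfolding biconnected_def using finC C(1) by simp
qed

text \<open>
  For a fixed vertex \<open>v\<close>, at least \<open>d * (d - 1)\<close> paths of length two start in \<open>v\<close> and end in one of the
  \<open>card V - 1\<close> other vertices. The end that is hit most often is the required \<open>u\<close>.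
\<close>

lemma many_common_nbrs:
  assumes sym: "symp E" and V: "finite V" "2 \<le> card V"
    and deg: "\<And>v. v \<in> V \<Longrightarrow> d \<le> card (nbrs E V v)"
  shows "\<exists>u \<in> V. \<exists>v \<in> V. u \<noteq> v \<and> d * (d - 1) \<le> (card V - 1) * card (nbrs E V u \<inter> nbrs E V v)"
proof (rule ccontr)
  assume neg: "\<not> ?thesis"
  obtain v where v: "v \<in> V" using V by fastforce
  have fN: "finite (nbrs E V v)" using V unfolding nbrs_def by simp
  have eq: "nbrs E (nbrs E V v) u = nbrs E V u \<inter> nbrs E V v" for u
    unfolding nbrs_def by auto
  have ne: "V - {v} \<noteq> {}" using exists_other[OF V(2), of v] by blast
  have "(\<Sum>u\<in>V - {v}. (card V - 1) * card (nbrs E (nbrs E V v) u)) < (\<Sum>u\<in>V - {v}. d * (d - 1))"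
    by (rule sum_strict_mono) (use V ne neg v eq in \<open>auto simp: not_le\<close>)
  also have "\<dots> = (card V - 1) * (d * (d - 1))"
    using V v by simp
  finally have "(\<Sum>u\<in>V - {v}. card (nbrs E (nbrs E V v) u)) < d * (d - 1)"
    by (simp add: sum_distrib_left[symmetric])
  also have "d * (d - 1) \<le> card (nbrs E V v) * (d - 1)"
    using deg[OF v] by simp
  also have "\<dots> \<le> (\<Sum>w\<in>nbrs E V v. card (nbrs E (V - {v}) w))"
  proof -
    have "d - 1 \<le> card (nbrs E (V - {v}) w)" if "w \<in> nbrs E V v" for w
    proof -
      have "nbrs E (V - {v}) w = nbrs E V w - {v}" unfolding nbrs_def by auto
      then show ?thesis
        using deg[of w] that diff_card_le_card_Diff[of "{v}" "nbrs E V w"] unfolding nbrs_def by simp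
    qed
    then show ?thesis
      using sum_bounded_below[of "nbrs E V v" "d - 1"] by simp
  qed
  also have "\<dots> = (\<Sum>u\<in>V - {v}. card (nbrs E (nbrs E V v) u))"
    by (rule sum_card_nbrs_swap[OF sym fN]) (use V in simp)
  finally show False by simp
qed

section \<open>All orders\<close>

text \<open>
  Common neighbours of one pair of vertices provide the orders up to \<open>K + 2\<close>. From \<open>K\<close> onwards the
  sets are large enough for \<open>biconnected_extend\<close>.
\<close>

lemma biconnected_all_orders:
  assumes sym: "symp E" and irr: "irreflp E" and V: "biconnected E V"
    and deg: "\<And>v. v \<in> V \<Longrightarrow> d \<le> card (nbrs E V v)" and d: "2 \<le> d"
    and num: "12 * (card V div (d - 1)) + 3 * (card V div (a + 1)) + a + 1 \<le> d"
      "card V * (3 * (card V div (d - 1)) + card V div (a + 1) + 2) \<le> d * (d - 1)"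
    and l: "4 \<le> l" "l \<le> card V"
  shows "\<exists>Y \<subseteq> V. biconnected E Y \<and> card Y = l"
proof -
  define K where "K = 3 * (card V div (d - 1)) + card V div (a + 1) + 2"
  have fin: "finite V" "3 \<le> card V" using V unfolding biconnected_def by auto
  obtain u v where uv: "u \<in> V" "v \<in> V" "u \<noteq> v"
    and "d * (d - 1) \<le> (card V - 1) * card (nbrs E V u \<inter> nbrs E V v)"
    using many_common_nbrs[OF sym fin(1) _ deg] fin(2) by auto
  then have "(card V - 1) * K \<le> (card V - 1) * card (nbrs E V u \<inter> nbrs E V v)"
    using num(2) mult_le_mono1[of "card V - 1" "card V" K] unfolding K_def[symmetric] by linarith
  then have K: "K \<le> card (nbrs E V u \<inter> nbrs E V v)"
    using fin(2) by simp
  have small: "\<exists>Y \<subseteq> V. biconnected E Y \<and> card Y = l" if "4 \<le> l" "l \<le> K + 2" for l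
  proof -
    have "l - 2 \<le> card (nbrs E V u \<inter> nbrs E V v)" using K that by simp
    then obtain C where C: "C \<subseteq> nbrs E V u \<inter> nbrs E V v" "card C = l - 2" "finite C"
      using obtain_subset_with_card_n by blast
    have "u \<notin> C" "v \<notin> C"
      using C(1) irr unfolding nbrs_def irreflp_def by auto
    moreover have "\<And>c. c \<in> C \<Longrightarrow> E u c \<and> E v c" "2 \<le> card C"
      using C that(1) unfolding nbrs_def by auto
    ultimately have "biconnected E ({u, v} \<union> C)"
      by (intro biconnected_common_nbrs[OF sym uv(3)])
    moreover have "card ({u, v} \<union> C) = l"
      using C(2,3) uv(3) \<open>u \<notin> C\<close> \<open>v \<notin> C\<close> \<open>4 \<le> l\<close> by simp
    moreover have "{u, v} \<union> C \<subseteq> V"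
      using uv C(1) unfolding nbrs_def by auto
    ultimately show ?thesis by blast
  qed
  show ?thesis
    using l
  proof (induction l rule: dec_induct)
    case base
    then show ?case using small[of 4] unfolding K_def by simp
  next
    case (step l)
    show ?case
    proof (cases "Suc l \<le> K + 2")
      case True
      then show ?thesis using small[of "Suc l"] step by simp
    next
      case False
      obtain X where X: "X \<subseteq> V" "biconnected E X" "card X = l"
        using step by auto
      have "\<exists>Y \<subseteq> V. biconnected E Y \<and> card Y = card X + 1"
        by (rule biconnected_extend[OF sym irr V deg d X(1) _ X(2) num(1)])
          (use X(3) step False in \<open>auto simp: K_def\<close>)
      then show ?thesis using X(3) by simp
    qed
  qed
qed

text \<open>
  The choice \<open>a = \<lfloor>c\<^sup>2\<rfloor>\<close> with \<open>c = n powr (1/3)\<close> balances the two losses: it costs half of the leading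
  term \<open>2 * c\<^sup>2\<close> of the degree, and leaves at most \<open>n / c\<^sup>2 = c\<close> vertices with more than \<open>a\<close>
  neighbours outside. Since \<open>n div (d - 1) \<le> c / 2\<close>, the first inequality reduces to
  \<open>c\<^sup>2 + 9 * c + 1 \<le> 2 * c\<^sup>2 + 6 * c + 2\<close>, which holds for \<open>c \<ge> 3\<close>. The condition \<open>d < n\<close> makes \<open>c\<close> that
  large. In the second inequality the left side is at most \<open>c ^ 3 * (5 / 2 * c + 2)\<close>, while the right side
  is at least \<open>4 * c ^ 4 + 24 * c ^ 3\<close>.
\<close>

lemma degree_bounds:
  fixes n d :: nat
  assumes d: "2 * real n powr (2 / 3) + 6 * real n powr (1 / 3) + 2 \<le> real d" and "d < n"
  obtains a where "12 * (n div (d - 1)) + 3 * (n div (a + 1)) + a + 1 \<le> d"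
    "n * (3 * (n div (d - 1)) + n div (a + 1) + 2) \<le> d * (d - 1)"
proof -
  define c where "c = real n powr (1 / 3)"
  have c0: "0 < c" unfolding c_def using \<open>d < n\<close> by simp
  have c2: "real n powr (2 / 3) = c ^ 2" and c3: "real n = c ^ 3"
    unfolding c_def using \<open>d < n\<close> by (simp_all add: powr_powr flip: powr_realpow powr_add)
  have d': "2 * c\<^sup>2 + 6 * c + 2 \<le> real d"
    using d unfolding c2 c_def[symmetric] .
  have "2 * c\<^sup>2 + 6 * c < c ^ 3"
    using d' \<open>d < n\<close> c3 by linarith
  then have "c * (c * c - 2 * c - 6) > 0"
    by (simp add: power2_eq_square power3_eq_cube algebra_simps)
  then have "c * c - 2 * c - 6 > 0"
    using c0 by (simp add: zero_less_mult_iff)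
  moreover have "c * c \<le> 3 * c" if "c \<le> 3"
    using that c0 by simp
  ultimately have "c > 3"
    by (smt (verit))
  define a where "a = nat \<lfloor>c\<^sup>2\<rfloor>"
  have a: "real a \<le> c\<^sup>2" "c\<^sup>2 < real a + 1"
    unfolding a_def by (simp_all add: of_nat_nat)
  define m where "m = n div (d - 1)"
  define q where "q = n div (a + 1)"
  have d1: "real (d - 1) = real d - 1"
  proof -
    have "1 \<le> real d" using d' c0 zero_le_power2[of c] by linarith
    then show ?thesis by simp
  qed
  have m: "real m \<le> c / 2"
  proof -
    have "real m * (real d - 1) \<le> real n"
      unfolding m_def d1[symmetric] by (metis of_nat_mult of_nat_le_iff div_times_less_eq_dividend)
    moreover have "real m * (2 * c\<^sup>2) \<le> real m * (real d - 1)"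
      using d' c0 by (intro mult_left_mono) auto
    ultimately have "c\<^sup>2 * (2 * real m) \<le> c\<^sup>2 * c"
      unfolding c3 by (simp add: power2_eq_square power3_eq_cube algebra_simps)
    then show ?thesis using c0 by simp
  qed
  have q: "real q \<le> c"
  proof -
    have "real q * (real a + 1) \<le> real n"
      unfolding q_def by (metis of_nat_mult of_nat_le_iff div_times_less_eq_dividend of_nat_1 of_nat_add)
    moreover have "real q * c\<^sup>2 \<le> real q * (real a + 1)"
      using a by (intro mult_left_mono) auto
    ultimately have "c\<^sup>2 * real q \<le> c\<^sup>2 * c"
      unfolding c3 by (simp add: power2_eq_square power3_eq_cube algebra_simps)
    then show ?thesis using c0 by simp
  qed
  have "3 * c \<le> c\<^sup>2"
    using \<open>c > 3\<close> c0 by (simp add: power2_eq_square)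
  then have "12 * real m + 3 * real q + real a + 1 \<le> real d"
    using m q a(1) d' by linarith
  then have "12 * m + 3 * q + a + 1 \<le> d"
    by linarith
  moreover have "n * (3 * m + q + 2) \<le> d * (d - 1)"
  proof -
    have "real n * (3 * real m + real q + 2) \<le> c ^ 3 * (5 / 2 * c + 2)"
      unfolding c3 using m q c0 by (intro mult_left_mono) auto
    also have "\<dots> \<le> (2 * c\<^sup>2 + 6 * c + 2) * (2 * c\<^sup>2 + 6 * c + 1)"
      using c0 by (simp add: power2_eq_square power3_eq_cube algebra_simps)
    also have "\<dots> \<le> real d * (real d - 1)"
      using d' c0 by (intro mult_mono) auto
    finally have "real (n * (3 * m + q + 2)) \<le> real (d * (d - 1))"
      unfolding of_nat_mult d1 by (simp add: add_ac)
    then show ?thesis by linarith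
  qed
  ultimately show thesis using that unfolding m_def q_def by blast
qed

section \<open>Back to graphs\<close>

lemma (in wf_digraph) connected_iff_linked:
  assumes "symmetric G"
  shows "Digraph_Component.connected G \<longleftrightarrow> verts G \<noteq> {} \<and> linked (dominates G) (verts G)"
proof -
  have "linked (dominates G) (verts G)" if reach: "\<And>u v. u \<in> verts G \<Longrightarrow> v \<in> verts G \<Longrightarrow> u \<rightarrow>\<^sup>* v"
    unfolding linked_def
  proof (intro allI impI)
    fix P assume P: "P \<subseteq> verts G" "P \<noteq> {}" "P \<noteq> verts G"
    then obtain p q where pq: "p \<in> P" "q \<in> verts G - P" by blast
    show "\<exists>p\<in>P. \<exists>q\<in>verts G - P. p \<rightarrow> q"
    proof (rule ccontr)
      assume closed: "\<not> ?thesis"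
      have "p \<rightarrow>\<^sup>* q" using reach pq P(1) by blast
      then have "q \<in> P"
      proof (induction rule: reachable_induct)
        case base
        then show ?case using pq by simp
      next
        case (step x y)
        then show ?case using closed adj_in_verts(2) by blast
      qed
      then show False using pq by simp
    qed
  qed
  moreover have "u \<rightarrow>\<^sup>* v" if link: "linked (dominates G) (verts G)" and uv: "u \<in> verts G" "v \<in> verts G" for u v
  proof (rule ccontr)
    assume nr: "\<not> u \<rightarrow>\<^sup>* v"
    obtain p q where "p \<in> {w \<in> verts G. u \<rightarrow>\<^sup>* w}" "q \<in> verts G - {w \<in> verts G. u \<rightarrow>\<^sup>* w}" "p \<rightarrow> q"
      by (rule linkedD[OF link, of "{w \<in> verts G. u \<rightarrow>\<^sup>* w}"]) (use uv nr in auto)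
    then show False using reachable_adj_trans by blast
  qed
  ultimately show ?thesis
    unfolding connected_def strongly_connected_def
    using reachable_mk_symmetric_eq[OF assms] by auto
qed

lemma (in graph) two_connected_iff_biconnected:
  "two_connected G \<longleftrightarrow> biconnected (dominates G) (verts G)"
proof -
  have "Digraph_Component.connected (del_vert v) \<longleftrightarrow> linked (dominates G) (verts G - {v})"
    if "3 \<le> card (verts G)" for v
  proof -
    interpret del: wf_digraph "del_vert v"
      by (rule wf_digraph_del_vert)
    have dom: "x \<rightarrow>\<^bsub>del_vert v\<^esub> y \<longleftrightarrow> x \<rightarrow> y \<and> x \<noteq> v \<and> y \<noteq> v" for x y
      unfolding arcs_ends_conv by (auto simp: del_vert_simps)
    have "symmetric (del_vert v)"
      using arcs_ends_symmetric[OF sym_arcs] unfolding symmetric_def sym_def dom by blast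
    moreover have "verts G - {v} \<noteq> {}"
      using exists_other[of "verts G" v] that by auto
    moreover have "linked (dominates (del_vert v)) (verts G - {v}) \<longleftrightarrow> linked (dominates G) (verts G - {v})"
      by (rule linked_cong) (simp add: dom)
    ultimately show ?thesis
      by (simp add: del.connected_iff_linked verts_del_vert)
  qed
  moreover have "verts G \<noteq> {}" if "3 \<le> card (verts G)"
    using that by auto
  ultimately show ?thesis
    unfolding two_connected_def biconnected_def
    using connected_iff_linked[OF sym_arcs] by auto
qed

theorem theorem3:
  fixes G :: "('a, 'b) pre_digraph" and n :: nat
  assumes "graph G"
    and "two_connected G"
    and "card (verts G) = n"
    and "real (min_degree G) \<ge> 2 * real n powr (2 / 3) + 6 * real n powr (1 / 3) + 2"
  shows "\<forall>l \<in> {4..n}. \<exists>H. graph H \<and> subgraph H G \<and> two_connected H \<and> card (verts H) = l"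
proof
  fix l assume l: "l \<in> {4..n}"
  interpret graph G by fact
  let ?d = "min_degree G"
  have sym: "symp (dominates G)"
    using arcs_ends_symmetric[OF sym_arcs] by (auto intro: sympI)
  have irr: "irreflp (dominates G)"
    using adj_not_same by (auto intro: irreflpI)
  have V: "biconnected (dominates G) (verts G)"
    using two_connected_iff_biconnected assms(2) by simp
  have deg: "?d \<le> card (nbrs (dominates G) (verts G) v)" if "v \<in> verts G" for v
  proof -
    have "?d \<le> out_degree G v"
      unfolding min_degree_def using that by (intro Min_le) auto
    moreover have "nbrs (dominates G) (verts G) v = {u. v \<rightarrow>\<^bsub>G\<^esub> u}"
      unfolding nbrs_def using adj_in_verts by auto
    ultimately show ?thesis by (simp add: out_degree_eq_card_neighbours)
  qed
  have "?d < n"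
  proof -
    obtain v where v: "v \<in> verts G" using l assms(3) by fastforce
    have "nbrs (dominates G) (verts G) v \<subset> verts G"
      using v irr unfolding nbrs_def irreflp_def by blast
    then have "card (nbrs (dominates G) (verts G) v) < card (verts G)"
      by (intro psubset_card_mono) auto
    then show ?thesis using deg[OF v] assms(3) by linarith
  qed
  moreover have "2 \<le> ?d"
  proof -
    have "2 \<le> real ?d"
      using assms(4) powr_ge_zero[of "real n" "2 / 3"] powr_ge_zero[of "real n" "1 / 3"] by linarith
    then show ?thesis by simp
  qed
  moreover obtain a where "12 * (n div (?d - 1)) + 3 * (n div (a + 1)) + a + 1 \<le> ?d"
    "n * (3 * (n div (?d - 1)) + n div (a + 1) + 2) \<le> ?d * (?d - 1)"
    using degree_bounds[OF assms(4) \<open>?d < n\<close>] by blast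
  ultimately obtain Y where Y: "Y \<subseteq> verts G" "biconnected (dominates G) Y" "card Y = l"
    using biconnected_all_orders[OF sym irr V deg, of a l] l assms(3) by auto
  have ind: "induced_subgraph (G \<restriction> Y) G"
    using Y(1) by blast
  interpret H: digraph "G \<restriction> Y"
    by (rule digraphI_induced[OF ind])
  have H: "graph (G \<restriction> Y)"
    using induced_graph_imp_symmetric[OF sym_arcs ind] by (rule H.graphI)
  have dom: "x \<rightarrow>\<^bsub>G \<restriction> Y\<^esub> y \<longleftrightarrow> x \<rightarrow>\<^bsub>G\<^esub> y" if "x \<in> Y" "y \<in> Y" for x y
    using that unfolding arcs_ends_conv by auto
  have cong: "linked (dominates (G \<restriction> Y)) S \<longleftrightarrow> linked (dominates G) S" if "S \<subseteq> Y" for S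
    by (rule linked_cong) (use dom that in blast)
  have "biconnected (dominates (G \<restriction> Y)) Y"
    using Y(2) unfolding biconnected_def by (simp add: cong)
  then have "two_connected (G \<restriction> Y)"
    using graph.two_connected_iff_biconnected[OF H] by simp
  then show "\<exists>H. graph H \<and> subgraph H G \<and> two_connected H \<and> card (verts H) = l"
    using H induced_imp_subgraph[OF ind] Y(3) by (intro exI[of _ "G \<restriction> Y"]) simp
qed

end
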